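(* Let $\mathcal{H}$ be a real Hilbert space, let $A\colon\mathcal{H}\to 2^{\mathcal{H}}$ and $B\colon\mathcal{H}\to 2^{\mathcal{H}}$ be maximally monotone, and let $$T=\mathrm{Id}-J_A+J_B\circ R_A$$ be the Douglas--Rachford operator associated with $(A,B)$. Suppose that $W$ is a subset of $\mathcal{H}$ which contains $\operatorname{ran}(\mathrm{Id}-T)$ and is such that for every $w\in W$ there exists $(a,b,p,q)\in\mathcal{H}^4$ satisfying $$w=a-b=p+q,\qquad \inf_{(x,u)\in\operatorname{gra}A}\langle x-a\mid u-p\rangle>-\infty,\qquad \inf_{(y,v)\in\operatorname{gra}B}\langle y-b\mid v-q\rangle>-\infty.$$ Then $\operatorname{ran}(\mathrm{Id}-T)\simeq W\simeq\operatorname{conv}W$.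
   Context: The scalar product of $\mathcal{H}$ is $\langle\cdot\mid\cdot\rangle$ and $\mathrm{Id}$ is the identity operator. For a set-valued operator $M\colon\mathcal{H}\to 2^{\mathcal{H}}$, $\operatorname{gra}M=\{(x,u)\in\mathcal{H}\times\mathcal{H}\mid u\in Mx\}$ and $\operatorname{ran}M=\bigcup_{x\in\mathcal{H}}Mx$. $M$ is monotone if $\langle x-y\mid u-v\rangle\geq 0$ for all $(x,u),(y,v)\in\operatorname{gra}M$, and maximally monotone if it is monotone and no monotone operator has a graph properly containing $\operatorname{gra}M$. For $M$ maximally monotone, the resolvent $J_M=(\mathrm{Id}+M)^{-1}$ is a single-valued operator defined on all of $\mathcal{H}$ (i.e., $J_Mx$ is the unique $y\in\mathcal{H}$ with $x-y\in My$), and the reflected resolvent is $R_M=2J_M-\mathrm{Id}$. For a subset $C$ of $\mathcal{H}$, $\operatorname{conv}C$ is its convex hull, $\overline{C}$ is its closure, and $\operatorname{rint}C$ is the interior of $C$ relative to the closed affine hull of $C$ (the smallest closed affine subspace of $\mathcal{H}$ containing $C$). For subsets $C,D$ of $\mathcal{H}$, $C\simeq D$ means that $\overline{C}=\overline{D}$ and $\operatorname{rint}C=\operatorname{rint}D$; $C\simeq D\simeq E$ means $C\simeq D$ and $D\simeq E$. *)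

theory Defs
  imports "HOL-Analysis.Analysis"
begin

text \<open>A real Hilbert space is a type of sort \<open>{real_inner, complete_space}\<close>; a set-valued
  operator on it is a function of type \<open>'a \<Rightarrow> 'a set\<close>.\<close>

definition gra :: "('a \<Rightarrow> 'b set) \<Rightarrow> ('a \<times> 'b) set" where
  "gra M = {(x, u). u \<in> M x}"

definition monotone_op :: "('a::real_inner \<Rightarrow> 'a set) \<Rightarrow> bool" where
  "monotone_op M \<longleftrightarrow> (\<forall>(x, u) \<in> gra M. \<forall>(y, v) \<in> gra M. (x - y) \<bullet> (u - v) \<ge> 0)"

definition maximally_monotone_op :: "('a::real_inner \<Rightarrow> 'a set) \<Rightarrow> bool" where
  "maximally_monotone_op M \<longleftrightarrow>
     monotone_op M \<and> \<not> (\<exists>N :: 'a \<Rightarrow> 'a set. monotone_op N \<and> gra M \<subset> gra N)"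

text \<open>The description is meaningful only where the point \<open>y\<close> exists and is unique, which is the
  case for every \<open>x\<close> when \<open>M\<close> is maximally monotone on a Hilbert space.\<close>

definition resolvent :: "('a::real_inner \<Rightarrow> 'a set) \<Rightarrow> 'a \<Rightarrow> 'a" where
  "resolvent M x = (THE y. x - y \<in> M y)"

definition reflected_resolvent :: "('a::real_inner \<Rightarrow> 'a set) \<Rightarrow> 'a \<Rightarrow> 'a" where
  "reflected_resolvent M x = 2 *\<^sub>R resolvent M x - x"

definition douglas_rachford ::
    "('a::real_inner \<Rightarrow> 'a set) \<Rightarrow> ('a \<Rightarrow> 'a set) \<Rightarrow> 'a \<Rightarrow> 'a" where
  "douglas_rachford A B x = x - resolvent A x + resolvent B (reflected_resolvent A x)"

definition closed_affine_hull :: "'a::real_normed_vector set \<Rightarrow> 'a set" where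
  "closed_affine_hull C = (\<lambda>S. affine S \<and> closed S) hull C"

text \<open>Unlike the library's \<open>rel_interior\<close>, the interior is taken relative to the \<^emph>\<open>closed\<close> affine
  hull; the two notions differ in infinite dimension.\<close>

definition rint :: "'a::real_normed_vector set \<Rightarrow> 'a set" where
  "rint C = top_of_set (closed_affine_hull C) interior_of C"

definition nearly_equal :: "'a::real_normed_vector set \<Rightarrow> 'a set \<Rightarrow> bool"
    (infix "\<simeq>" 50) where
  "C \<simeq> D \<longleftrightarrow> closure C = closure D \<and> rint C = rint D"

end

theory Submission
  imports Defs
begin

text \<open>Write \<open>F = Id - T\<close>. For \<open>x\<close> put \<open>a = J\<^sub>A x\<close>, \<open>b = J\<^sub>B (R\<^sub>A x)\<close>; then \<open>x = a + u\<close> and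
  \<open>F x = a - b = u + v\<close> with \<open>u \<in> A a\<close> and \<open>v \<in> B b\<close>, so the value \<open>F x\<close> has the same two
  representations, as a difference and as a sum, that the hypothesis demands of \<open>w \<in> W\<close>. A purely
  algebraic identity (\<open>douglas_rachford_displacement_inner\<close>) compares two such representations. Applied
  to two values of \<open>F\<close> it shows that \<open>F\<close> is firmly nonexpansive; applied to \<open>F x\<close> and \<open>w \<in> W\<close> it
  shows that \<open>w\<close> lies in the set of all \<open>w\<close> for which \<open>(x - z) \<bullet> (F x - w)\<close> is bounded below in \<open>x\<close>
  for some \<open>z\<close>. Call that set \<open>P\<close>. It is convex, so
  \<open>ran F \<subseteq> W \<subseteq> conv W \<subseteq> P\<close>.

  What remains is a Brezis--Haraux argument: \<open>P \<subseteq> closure (ran F)\<close> and \<open>rint P \<subseteq> ran F\<close>, which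
  forces all the sets in the chain to be nearly equal. Both inclusions come from the Tikhonov
  regularization \<open>\<epsilon> x + F x = w\<close>, which is solvable by the Banach fixed point theorem. For
  \<open>w \<in> P\<close> the solutions satisfy \<open>\<epsilon> \<parallel>x\<parallel>\<^sup>2 = O(1)\<close>, hence \<open>F x \<rightarrow> w\<close>. For \<open>w \<in> rint P\<close> the solutions
  are pointwise bounded on the direction space of the closed affine hull, a Hilbert space that
  contains them, hence bounded in norm by uniform boundedness; and a bounded family of Tikhonov
  solutions is Cauchy as \<open>\<epsilon> \<rightarrow> 0\<close>, so that its strong limit \<open>y\<close> satisfies \<open>F y = w\<close>.

  That the resolvents are well defined is Minty's theorem. It follows by minimising
  \<open>f + \<parallel>\<cdot>\<parallel>\<^sup>2 / 2\<close>, where \<open>f\<close> is the Fitzpatrick function of the operator; strong convexity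
  makes every minimising sequence Cauchy.\<close>

section \<open>Minty's theorem and resolvents\<close>

text \<open>When \<open>C\<close> is the epigraph of a closed convex function \<open>f\<close>, the point \<open>z0\<close> minimises
  \<open>f + \<parallel>\<cdot>\<parallel>\<^sup>2 / 2\<close>, and the last conclusion is the optimality condition \<open>- z0 \<in> \<partial>f z0\<close>. Working with the
  epigraph avoids extended real values.\<close>

lemma closed_convex_tilted_minimum:
  fixes C :: "('b::{real_inner, complete_space} \<times> real) set"
  assumes "closed C" "convex C" "C \<noteq> {}"
    and lb: "\<And>z t. (z, t) \<in> C \<Longrightarrow> 0 \<le> t + (norm z)\<^sup>2 / 2"
  obtains z0 t0 where "(z0, t0) \<in> C" "\<And>z t. (z, t) \<in> C \<Longrightarrow> t0 - z0 \<bullet> (z - z0) \<le> t"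
proof -
  define g :: "'b \<times> real \<Rightarrow> real" where "g = (\<lambda>(z, t). t + (norm z)\<^sup>2 / 2)"
  define m where "m = (INF p\<in>C. g p)"
  have bdd: "bdd_below (g ` C)"
    using lb by (intro bdd_belowI2[of _ 0]) (auto simp: g_def)
  have m_le: "m \<le> g p" if "p \<in> C" for p
    unfolding m_def using bdd that by (rule cINF_lower)
  \<comment> \<open>Near-minimisers are close to each other: the parallelogram law at their midpoint.\<close>
  have gap: "(norm (z - z'))\<^sup>2 \<le> 4 * (g (z, t) - m) + 4 * (g (z', t') - m)"
    if "(z, t) \<in> C" "(z', t') \<in> C" for z z' t t'
  proof -
    have "(1/2) *\<^sub>R (z, t) + (1/2) *\<^sub>R (z', t') \<in> C"
      using assms(2) that by (intro convexD) auto
    then have "m \<le> g ((1/2) *\<^sub>R z + (1/2) *\<^sub>R z', t/2 + t'/2)"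
      using m_le by fastforce
    also have "\<dots> = (g (z, t) + g (z', t')) / 2 - (norm (z - z'))\<^sup>2 / 8"
      unfolding g_def prod.case power2_norm_eq_inner
      by (simp add: inner_simps inner_commute field_simps)
    finally show ?thesis by (simp add: field_simps)
  qed
  have "\<exists>p\<in>C. g p < m + inverse (real (Suc n))" for n
    using cInf_lessD[of "g ` C" "m + inverse (real (Suc n))"] assms(3)
    unfolding m_def by auto
  then obtain p where p: "\<And>n. p n \<in> C" "\<And>n. g (p n) < m + inverse (real (Suc n))"
    by metis
  define z t where "z n = fst (p n)" and "t n = snd (p n)" for n
  have zt: "p n = (z n, t n)" for n by (simp add: z_def t_def)
  have inv0: "(\<lambda>n. inverse (real (Suc n))) \<longlonglongrightarrow> 0"
    by (rule LIMSEQ_inverse_real_of_nat)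
  have "Cauchy z"
  proof (rule CauchyI')
    fix e :: real assume "0 < e"
    then have "0 < e\<^sup>2 / 8" by simp
    then obtain N where N: "inverse (real (Suc N)) < e\<^sup>2 / 8"
      using reals_Archimedean by blast
    have small: "g (p n) - m < e\<^sup>2 / 8" if "n \<ge> N" for n
    proof -
      have "inverse (real (Suc n)) \<le> inverse (real (Suc N))"
        using that by (intro le_imp_inverse_le) auto
      then show ?thesis using p(2)[of n] N by linarith
    qed
    have "dist (z i) (z j) < e" if "i \<ge> N" "j > i" for i j
    proof -
      have "(norm (z i - z j))\<^sup>2 \<le> 4 * (g (p i) - m) + 4 * (g (p j) - m)"
        using gap p(1) by (simp add: zt)
      also have "\<dots> < e\<^sup>2" using small[of i] small[of j] that by simp
      finally show ?thesis
        using \<open>0 < e\<close> by (simp add: dist_norm power2_less_imp_less)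
    qed
    then show "\<exists>M. \<forall>i\<ge>M. \<forall>j>i. dist (z i) (z j) < e" by blast
  qed
  then obtain z0 where z0: "z \<longlonglongrightarrow> z0"
    by (auto simp: Cauchy_convergent_iff convergent_def)
  have glim: "(\<lambda>n. g (p n)) \<longlonglongrightarrow> m"
  proof (rule tendsto_sandwich[where f = "\<lambda>_. m" and h = "\<lambda>n. m + inverse (real (Suc n))"])
    show "(\<lambda>n. m + inverse (real (Suc n))) \<longlonglongrightarrow> m"
      using tendsto_add[OF tendsto_const inv0] by simp
  qed (use m_le p in \<open>auto intro!: always_eventually less_imp_le\<close>)
  define t0 where "t0 = m - (norm z0)\<^sup>2 / 2"
  have "t = (\<lambda>n. g (p n) - (norm (z n))\<^sup>2 / 2)"
    by (simp add: g_def zt)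
  then have "t \<longlonglongrightarrow> t0"
    unfolding t0_def using glim z0 by (auto intro!: tendsto_intros)
  with z0 have "(\<lambda>n. (z n, t n)) \<longlonglongrightarrow> (z0, t0)" by (rule tendsto_Pair)
  then have in0: "(z0, t0) \<in> C"
    using closed_sequentially[OF assms(1), of "\<lambda>n. (z n, t n)"] p(1) by (simp add: zt)
  have "t0 - z0 \<bullet> (z - z0) \<le> t" if "(z, t) \<in> C" for z t
  proof -
    \<comment> \<open>The one-sided derivative of the minimised function at the minimiser, towards \<open>(z, t)\<close>, is
      nonnegative.\<close>
    define d where "d = t - t0 + z0 \<bullet> (z - z0)"
    have quad: "0 \<le> d + s * ((norm (z - z0))\<^sup>2 / 2)" if s: "0 < s" "s \<le> 1" for s
    proof -
      have "(1 - s) *\<^sub>R (z0, t0) + s *\<^sub>R (z, t) \<in> C"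
        using assms(2) in0 \<open>(z, t) \<in> C\<close> s by (intro convexD) auto
      then have "m \<le> g ((1 - s) *\<^sub>R z0 + s *\<^sub>R z, (1 - s) * t0 + s * t)"
        using m_le by fastforce
      also have "(1 - s) *\<^sub>R z0 + s *\<^sub>R z = z0 + s *\<^sub>R (z - z0)"
        by (simp add: algebra_simps)
      also have "g (z0 + s *\<^sub>R (z - z0), (1 - s) * t0 + s * t)
          = m + s * (d + s * ((norm (z - z0))\<^sup>2 / 2))"
        unfolding g_def prod.case t0_def d_def power2_norm_eq_inner
        by (simp add: inner_simps inner_commute[of z z0] field_simps)
      finally show ?thesis using s by (simp add: zero_le_mult_iff)
    qed
    have "0 \<le> d"
    proof (rule tendsto_lowerbound)
      show "((\<lambda>s. d + s * ((norm (z - z0))\<^sup>2 / 2)) \<longlongrightarrow> d) (at_right 0)"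
        by (auto intro!: tendsto_eq_intros)
      show "\<forall>\<^sub>F s in at_right 0. 0 \<le> d + s * ((norm (z - z0))\<^sup>2 / 2)"
        unfolding eventually_at_right_field using quad by (intro exI[of _ 1]) auto
    qed simp
    then show ?thesis by (simp add: d_def)
  qed
  with in0 show ?thesis by (rule that)
qed

text \<open>Let \<open>f (x, u) = sup {x \<bullet> v + y \<bullet> u - y \<bullet> v | (y, v) \<in> G}\<close> be the Fitzpatrick function of \<open>G\<close>.
  Maximality gives \<open>f (x, u) \<ge> x \<bullet> u\<close>, and monotonicity gives \<open>f (y, v) = y \<bullet> v\<close> on \<open>G\<close>. At the
  minimiser \<open>(x0, u0)\<close> of \<open>f + \<parallel>\<cdot>\<parallel>\<^sup>2 / 2\<close>, the optimality condition tested on \<open>G\<close> says that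
  \<open>(- u0, - x0)\<close> is monotonically related to \<open>G\<close>, with the surplus \<open>\<parallel>x0 + u0\<parallel>\<^sup>2\<close>. So this point is in
  \<open>G\<close>, and comparing it with itself gives \<open>u0 = - x0\<close>.\<close>

lemma Minty_graph:
  fixes G :: "('a::{real_inner, complete_space} \<times> 'a) set"
  assumes mono: "\<And>x u y v. (x, u) \<in> G \<Longrightarrow> (y, v) \<in> G \<Longrightarrow> 0 \<le> (x - y) \<bullet> (u - v)"
    and max: "\<And>x u. (\<And>y v. (y, v) \<in> G \<Longrightarrow> 0 \<le> (x - y) \<bullet> (u - v)) \<Longrightarrow> (x, u) \<in> G"
  shows "\<exists>x. (x, - x) \<in> G"
proof -
  define H where "H = (\<lambda>(y, v). {((x, u), t) | x u t. x \<bullet> v + y \<bullet> u - y \<bullet> v \<le> t}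
                          :: (('a \<times> 'a) \<times> real) set)"
  define C where "C = (\<Inter>p\<in>G. H p)"
  have C_iff: "((x, u), t) \<in> C \<longleftrightarrow> (\<forall>(y, v)\<in>G. x \<bullet> v + y \<bullet> u - y \<bullet> v \<le> t)" for x u t
    by (auto simp: C_def H_def)
  have "closed (H p)" for p
  proof -
    have "H p = {q. fst (fst q) \<bullet> snd p + fst p \<bullet> snd (fst q) - fst p \<bullet> snd p \<le> snd q}"
      by (auto simp: H_def split: prod.splits)
    then show ?thesis by (auto intro!: closed_Collect_le continuous_intros)
  qed
  then have "closed C" unfolding C_def by blast
  have "convex C"
  proof (rule convexI)
    fix p q :: "('a \<times> 'a) \<times> real" and \<mu> \<nu> :: real
    assume pq: "p \<in> C" "q \<in> C" and s: "0 \<le> \<mu>" "0 \<le> \<nu>" "\<mu> + \<nu> = 1"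
    obtain x u t where p: "p = ((x, u), t)" by (metis prod.exhaust)
    obtain x' u' t' where q: "q = ((x', u'), t')" by (metis prod.exhaust)
    have "(\<mu> *\<^sub>R x + \<nu> *\<^sub>R x') \<bullet> v + y \<bullet> (\<mu> *\<^sub>R u + \<nu> *\<^sub>R u') - y \<bullet> v \<le> \<mu> * t + \<nu> * t'"
      if "(y, v) \<in> G" for y v
    proof -
      have "\<mu> * (x \<bullet> v + y \<bullet> u - y \<bullet> v) \<le> \<mu> * t" "\<nu> * (x' \<bullet> v + y \<bullet> u' - y \<bullet> v) \<le> \<nu> * t'"
        using pq that s by (auto simp: p q C_iff intro!: mult_left_mono)
      moreover have "(\<mu> + \<nu>) * (y \<bullet> v) = y \<bullet> v" using s by simp
      ultimately show ?thesis by (simp add: inner_simps algebra_simps)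
    qed
    then show "\<mu> *\<^sub>R p + \<nu> *\<^sub>R q \<in> C" by (auto simp: p q C_iff)
  qed
  have graph: "((y, v), y \<bullet> v) \<in> C" if "(y, v) \<in> G" for y v
    unfolding C_iff
  proof clarify
    fix y' v' assume "(y', v') \<in> G"
    with mono[OF that this] show "y \<bullet> v' + y' \<bullet> v - y' \<bullet> v' \<le> y \<bullet> v"
      by (simp add: inner_simps)
  qed
  have "G \<noteq> {}" using max by auto
  then obtain y v where "(y, v) \<in> G" by auto
  then have "C \<noteq> {}" using graph by blast
  have above: "x \<bullet> u \<le> t" if "((x, u), t) \<in> C" for x u t
  proof (rule ccontr)
    assume "\<not> x \<bullet> u \<le> t"
    then have strict: "0 < (x - y) \<bullet> (u - v)" if "(y, v) \<in> G" for y v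
      using \<open>((x, u), t) \<in> C\<close> that by (fastforce simp: C_iff inner_simps)
    then have "(x, u) \<in> G" by (intro max) (simp add: less_imp_le)
    then show False using strict by fastforce
  qed
  have "0 \<le> t + (norm z)\<^sup>2 / 2" if zt: "(z, t) \<in> C" for z t
  proof -
    obtain x u where z: "z = (x, u)" by fastforce
    have "0 \<le> (norm (x + u))\<^sup>2 / 2" by simp
    also have "\<dots> = x \<bullet> u + (norm z)\<^sup>2 / 2"
      unfolding power2_norm_eq_inner by (simp add: z inner_simps inner_commute field_simps)
    also have "\<dots> \<le> t + (norm z)\<^sup>2 / 2" using above zt z by simp
    finally show ?thesis .
  qed
  from closed_convex_tilted_minimum[OF \<open>closed C\<close> \<open>convex C\<close> \<open>C \<noteq> {}\<close> this]
  obtain z0 t0 where z0: "(z0, t0) \<in> C"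
    and sub: "\<And>z t. (z, t) \<in> C \<Longrightarrow> t0 - z0 \<bullet> (z - z0) \<le> t" by metis
  obtain x0 u0 where xu: "z0 = (x0, u0)" by fastforce
  have t0: "x0 \<bullet> u0 \<le> t0" using above z0 xu by simp
  have key: "(norm (x0 + u0))\<^sup>2 \<le> (- u0 - y) \<bullet> (- x0 - v)" if "(y, v) \<in> G" for y v
  proof -
    have "((y, v), y \<bullet> v) \<in> C" using that by (rule graph)
    then have "t0 - z0 \<bullet> ((y, v) - z0) \<le> y \<bullet> v" by (rule sub)
    then show ?thesis using t0
      unfolding power2_norm_eq_inner by (simp add: xu inner_simps inner_commute)
  qed
  have "(- u0, - x0) \<in> G"
    by (rule max) (meson key order_trans zero_le_power2)
  moreover from key[OF this] have "u0 = - x0"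
    by (simp add: add_eq_0_iff)
  ultimately show ?thesis by auto
qed

lemma maximally_monotone_opD:
  assumes "maximally_monotone_op M"
  shows maximally_monotone_op_mono: "\<And>x u y v. u \<in> M x \<Longrightarrow> v \<in> M y \<Longrightarrow> 0 \<le> (x - y) \<bullet> (u - v)"
    and maximally_monotone_op_mem:
      "\<And>x u. (\<And>y v. v \<in> M y \<Longrightarrow> 0 \<le> (x - y) \<bullet> (u - v)) \<Longrightarrow> u \<in> M x"
proof -
  show mono: "0 \<le> (x - y) \<bullet> (u - v)" if "u \<in> M x" "v \<in> M y" for x u y v
    using assms that by (auto simp: maximally_monotone_op_def monotone_op_def gra_def)
  fix x u
  assume rel: "\<And>y v. v \<in> M y \<Longrightarrow> 0 \<le> (x - y) \<bullet> (u - v)"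
  \<comment> \<open>The monotone enlargement of \<open>M\<close> by the single pair \<open>(x, u)\<close>.\<close>
  define N where "N = M(x := insert u (M x))"
  have sym: "0 \<le> (y - x) \<bullet> (v - u)" if "v \<in> M y" for y v
    using rel[OF that] by (simp add: inner_simps)
  have "monotone_op N"
    using mono rel sym
    by (auto simp: monotone_op_def gra_def N_def split: if_splits)
  moreover have "gra M \<subseteq> gra N" by (auto simp: gra_def N_def)
  ultimately have "gra N = gra M"
    using assms by (auto simp: maximally_monotone_op_def)
  moreover have "(x, u) \<in> gra N" by (simp add: gra_def N_def)
  ultimately show "u \<in> M x" by (simp add: gra_def)
qed

text \<open>Minty's theorem is applied to the translated operator \<open>M - x\<close>.\<close>

lemma resolvent_mem:
  fixes M :: "'a::{real_inner, complete_space} \<Rightarrow> 'a set"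
  assumes "maximally_monotone_op M"
  shows "x - resolvent M x \<in> M (resolvent M x)"
proof -
  note mono = maximally_monotone_op_mono[OF assms]
    and mem = maximally_monotone_op_mem[OF assms]
  have "\<exists>y. (y, - y) \<in> {(y, w). w + x \<in> M y}"
  proof (rule Minty_graph)
    fix a u b v
    assume "(a, u) \<in> {(y, w). w + x \<in> M y}" "(b, v) \<in> {(y, w). w + x \<in> M y}"
    then show "0 \<le> (a - b) \<bullet> (u - v)" using mono[of "u + x" a "v + x" b] by simp
  next
    fix a u
    assume rel: "\<And>b v. (b, v) \<in> {(y, w). w + x \<in> M y} \<Longrightarrow> 0 \<le> (a - b) \<bullet> (u - v)"
    have "u + x \<in> M a"
    proof (rule mem)
      fix b v assume "v \<in> M b"
      then show "0 \<le> (a - b) \<bullet> (u + x - v)" using rel[of b "v - x"] by (simp add: algebra_simps)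
    qed
    then show "(a, u) \<in> {(y, w). w + x \<in> M y}" by simp
  qed
  then obtain y where y: "x - y \<in> M y" by auto
  have "y' = y" if "x - y' \<in> M y'" for y'
  proof -
    have "0 \<le> (y' - y) \<bullet> (x - y' - (x - y))" using mono[OF that y] .
    also have "\<dots> = - ((y' - y) \<bullet> (y' - y))" by (simp add: inner_simps)
    finally have "y' - y = 0" by (metis inner_gt_zero_iff neg_0_le_iff_le not_less)
    then show ?thesis by simp
  qed
  with y show ?thesis unfolding resolvent_def by (rule theI)
qed

section \<open>The displacement of the Douglas--Rachford operator\<close>

text \<open>The identity that links the two operators to the displacement: it turns lower bounds for
  \<open>(a1 - a) \<bullet> (u1 - p)\<close> and \<open>(b1 - b) \<bullet> (v1 - q)\<close>, be they from monotonicity or from the hypothesis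
  on \<open>W\<close>, into one for the displacement mapping, whose argument \<open>a1 + u1\<close> is paired with the
  base point \<open>a + p\<close>.\<close>

lemma douglas_rachford_displacement_inner:
  fixes a b p q a1 u1 b1 v1 w :: "'a::real_inner"
  assumes "w = a - b" "w = p + q" "a1 - b1 = u1 + v1"
  shows "(a1 + u1 - (a + p)) \<bullet> (a1 - b1 - w)
    = (norm (a1 - b1 - w))\<^sup>2 + ((a1 - a) \<bullet> (u1 - p) + (b1 - b) \<bullet> (v1 - q))"
proof -
  define d where "d = a1 - b1 - w"
  define \<alpha> \<mu> where "\<alpha> = a1 - a" and "\<mu> = u1 - p"
  have "b1 - b = \<alpha> - d"
    using assms(1) by (simp add: d_def \<alpha>_def algebra_simps)
  moreover have "v1 - q = d - \<mu>"
    unfolding d_def \<mu>_def using assms(2,3) by (simp add: algebra_simps)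
  moreover have "a1 + u1 - (a + p) = \<alpha> + \<mu>" by (simp add: \<alpha>_def \<mu>_def)
  moreover have "(\<alpha> + \<mu>) \<bullet> d = (norm d)\<^sup>2 + (\<alpha> \<bullet> \<mu> + (\<alpha> - d) \<bullet> (d - \<mu>))"
    unfolding power2_norm_eq_inner by (simp add: inner_simps inner_commute)
  ultimately show ?thesis
    unfolding d_def[symmetric] \<alpha>_def[symmetric] \<mu>_def[symmetric] by (simp only:)
qed

lemma douglas_rachford_split:
  fixes A B :: "'a::{real_inner, complete_space} \<Rightarrow> 'a set"
  assumes "maximally_monotone_op A" "maximally_monotone_op B"
  obtains a u b v where "u \<in> A a" "v \<in> B b" "x = a + u" "a - b = u + v"
    "x - douglas_rachford A B x = a - b"
proof -
  define a where "a = resolvent A x"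
  define b where "b = resolvent B (2 *\<^sub>R a - x)"
  show thesis
  proof (rule that)
    show "x - a \<in> A a" unfolding a_def by (rule resolvent_mem) fact
    show "2 *\<^sub>R a - x - b \<in> B b" unfolding b_def by (rule resolvent_mem) fact
    show "x - douglas_rachford A B x = a - b"
      by (simp add: douglas_rachford_def reflected_resolvent_def a_def b_def)
  qed (simp_all add: scaleR_2)
qed

section \<open>Relative interior and near equality\<close>

lemma rint_iff:
  "y \<in> rint C \<longleftrightarrow> y \<in> closed_affine_hull C \<and>
     (\<exists>r>0. \<forall>z\<in>closed_affine_hull C. dist z y < r \<longrightarrow> z \<in> C)"
  (is "_ \<longleftrightarrow> ?R")
proof
  assume "y \<in> rint C"
  then obtain U where "openin (top_of_set (closed_affine_hull C)) U" "y \<in> U" "U \<subseteq> C"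
    by (auto simp: rint_def interior_of_def)
  then show ?R unfolding openin_euclidean_subtopology_iff by blast
next
  assume ?R
  then obtain r where r: "y \<in> closed_affine_hull C" "0 < r"
    "\<And>z. z \<in> closed_affine_hull C \<Longrightarrow> dist z y < r \<Longrightarrow> z \<in> C" by blast
  have "openin (top_of_set (closed_affine_hull C)) (closed_affine_hull C \<inter> ball y r)"
    by (simp add: openin_open_Int)
  moreover have "y \<in> closed_affine_hull C \<inter> ball y r" using r by simp
  moreover have "closed_affine_hull C \<inter> ball y r \<subseteq> C"
    using r(3) by (auto simp: dist_commute)
  ultimately show "y \<in> rint C" by (auto simp: rint_def interior_of_def)
qed

lemma closed_affine_hull_cong_closure:
  assumes "closure C = closure D"
  shows "closed_affine_hull C = closed_affine_hull D"
proof -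
  have "C \<subseteq> S \<longleftrightarrow> D \<subseteq> S" if "closed S" for S
    using assms that by (metis closure_minimal closure_subset order_trans)
  then have "{S. (affine S \<and> closed S) \<and> C \<subseteq> S} = {S. (affine S \<and> closed S) \<and> D \<subseteq> S}" by blast
  then show ?thesis by (simp add: closed_affine_hull_def hull_def)
qed

lemma
  shows subset_closed_affine_hull: "C \<subseteq> closed_affine_hull C"
    and affine_closed_affine_hull: "affine (closed_affine_hull C)"
    and closed_closed_affine_hull: "closed (closed_affine_hull C)"
proof -
  show "C \<subseteq> closed_affine_hull C"
    unfolding closed_affine_hull_def by (rule hull_subset)
  show "affine (closed_affine_hull C)"
    unfolding closed_affine_hull_def hull_def by (intro affine_Inter) blast
  show "closed (closed_affine_hull C)"
    unfolding closed_affine_hull_def hull_def by (intro closed_Inter) blast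
qed

text \<open>The three sets have the same closure, hence the same closed affine hull, so their relative
  interiors are taken in one and the same topology. There \<open>rint E\<close> is an open subset of \<open>C\<close> and thus
  part of \<open>rint C\<close>.\<close>

lemma nearly_equal_if_sandwiched:
  assumes "C \<subseteq> D" "D \<subseteq> E" "E \<subseteq> closure C" "rint E \<subseteq> C"
  shows "C \<simeq> D"
proof -
  have "closure C \<subseteq> closure D" "closure D \<subseteq> closure E"
    using assms by (simp_all add: closure_mono)
  moreover have "closure E \<subseteq> closure C"
    using closure_mono[OF assms(3)] by simp
  ultimately have cl: "closure C = closure D" "closure C = closure E" by blast+
  note hull = closed_affine_hull_cong_closure[OF cl(1)] closed_affine_hull_cong_closure[OF cl(2)]
  have "rint C \<subseteq> rint D"
    unfolding rint_def hull(1) using assms(1) by (rule interior_of_mono)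
  moreover have "rint D \<subseteq> rint C"
  proof -
    have "rint D \<subseteq> rint E"
      unfolding rint_def hull(1)[symmetric] hull(2) using assms(2) by (rule interior_of_mono)
    also have "rint E \<subseteq> rint C"
      unfolding rint_def hull(2)
      using assms(4) by (intro interior_of_maximal) (auto simp: rint_def)
    finally show ?thesis .
  qed
  ultimately show ?thesis using cl by (simp add: nearly_equal_def)
qed

section \<open>A Brezis--Haraux theorem for firmly nonexpansive mappings\<close>

text \<open>The set \<open>P\<close> of the introduction. The base point \<open>z\<close> may depend on \<open>w\<close>; for the
  Douglas--Rachford operator it is \<open>a + p\<close>, with the \<open>a\<close> and \<open>p\<close> that belong to \<open>w\<close>.\<close>

definition brezis_haraux_set :: "('a::real_inner \<Rightarrow> 'a) \<Rightarrow> 'a set" where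
  "brezis_haraux_set F = {w. \<exists>z c. \<forall>x. c \<le> (x - z) \<bullet> (F x - w)}"

text \<open>In \<open>(x - z) \<bullet> (F x - w)\<close> the only term that is not affine in the data \<open>(z, w)\<close> is the
  constant \<open>z \<bullet> w\<close>, so the base points may be averaged along with the points \<open>w\<close>.\<close>

lemma convex_brezis_haraux_set: "convex (brezis_haraux_set F)"
proof (rule convexI)
  fix w w' :: 'a and \<mu> \<nu> :: real
  assume w: "w \<in> brezis_haraux_set F" "w' \<in> brezis_haraux_set F"
    and s: "0 \<le> \<mu>" "0 \<le> \<nu>" "\<mu> + \<nu> = 1"
  from w obtain z c z' c' where
    zc: "\<And>x. c \<le> (x - z) \<bullet> (F x - w)" "\<And>x. c' \<le> (x - z') \<bullet> (F x - w')"
    unfolding brezis_haraux_set_def by blast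
  define z'' w'' where "z'' = \<mu> *\<^sub>R z + \<nu> *\<^sub>R z'" and "w'' = \<mu> *\<^sub>R w + \<nu> *\<^sub>R w'"
  have "\<mu> * c + \<nu> * c' - \<mu> * (z \<bullet> w) - \<nu> * (z' \<bullet> w') + z'' \<bullet> w'' \<le> (x - z'') \<bullet> (F x - w'')" for x
  proof -
    have "\<mu> * c + \<nu> * c' \<le> \<mu> * ((x - z) \<bullet> (F x - w)) + \<nu> * ((x - z') \<bullet> (F x - w'))"
      using zc s by (intro add_mono mult_left_mono) auto
    also have "\<dots> = (\<mu> + \<nu>) * (x \<bullet> F x) - z'' \<bullet> F x - x \<bullet> w'' + \<mu> * (z \<bullet> w) + \<nu> * (z' \<bullet> w')"
      by (simp add: z''_def w''_def inner_simps algebra_simps)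
    finally show ?thesis using s by (simp add: inner_simps)
  qed
  then show "\<mu> *\<^sub>R w + \<nu> *\<^sub>R w' \<in> brezis_haraux_set F"
    unfolding brezis_haraux_set_def w''_def by blast
qed

text \<open>With the nonexpansive mapping \<open>T = Id - F\<close> the equation is the fixed point equation of the
  contraction \<open>x \<mapsto> (y + T x) / (1 + \<epsilon>)\<close>.\<close>

lemma tikhonov_solution_exists:
  fixes F :: "'a::{real_inner, complete_space} \<Rightarrow> 'a"
  assumes firm: "\<And>x y. (norm (F x - F y))\<^sup>2 \<le> (x - y) \<bullet> (F x - F y)" and "0 < \<epsilon>"
  shows "\<exists>x. \<epsilon> *\<^sub>R x + F x = y"
proof -
  define T where "T x = x - F x" for x
  have T: "norm (T x - T y) \<le> norm (x - y)" for x y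
  proof (rule power2_le_imp_le)
    have "(norm (T x - T y))\<^sup>2 = (norm (x - y))\<^sup>2 - 2 * ((x - y) \<bullet> (F x - F y)) + (norm (F x - F y))\<^sup>2"
      unfolding power2_norm_eq_inner T_def by (simp add: inner_simps inner_commute algebra_simps)
    then show "(norm (T x - T y))\<^sup>2 \<le> (norm (x - y))\<^sup>2"
      using firm[of x y] zero_le_power2[of "norm (F x - F y)"] by linarith
  qed simp
  have "\<exists>!x. inverse (1 + \<epsilon>) *\<^sub>R (y + T x) = x"
  proof (rule banach_fix_type)
    show "0 \<le> inverse (1 + \<epsilon>)" "inverse (1 + \<epsilon>) < 1"
      using assms(2) by (auto simp: field_simps)
    show "\<forall>x x'. dist (inverse (1 + \<epsilon>) *\<^sub>R (y + T x)) (inverse (1 + \<epsilon>) *\<^sub>R (y + T x'))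
        \<le> inverse (1 + \<epsilon>) * dist x x'"
      using T assms(2) by (simp add: dist_norm flip: scaleR_diff_right)
  qed
  then obtain x where "inverse (1 + \<epsilon>) *\<^sub>R (y + T x) = x" by blast
  then have "(1 + \<epsilon>) *\<^sub>R (inverse (1 + \<epsilon>) *\<^sub>R (y + T x)) = (1 + \<epsilon>) *\<^sub>R x" by simp
  then have "y + T x = (1 + \<epsilon>) *\<^sub>R x" using assms(2) by simp
  then have "\<epsilon> *\<^sub>R x + F x = y" by (simp add: T_def algebra_simps)
  then show ?thesis by blast
qed

text \<open>Substituting \<open>F x = w - \<epsilon> x\<close> into the Brezis--Haraux condition at \<open>w + e\<close>. The case \<open>e = 0\<close>
  controls \<open>\<epsilon> \<parallel>x\<parallel>\<^sup>2\<close> and gives the closure inclusion; varying \<open>e\<close> controls \<open>x \<bullet> e\<close>, which feeds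
  uniform boundedness.\<close>

lemma tikhonov_bound:
  fixes F :: "'a::real_inner \<Rightarrow> 'a"
  assumes "w + e \<in> brezis_haraux_set F"
  obtains K where
    "\<And>\<epsilon> x. 0 < \<epsilon> \<Longrightarrow> \<epsilon> \<le> 1 \<Longrightarrow> \<epsilon> *\<^sub>R x + F x = w \<Longrightarrow> \<epsilon> * (norm x)\<^sup>2 / 2 + x \<bullet> e \<le> K"
proof -
  obtain z c where zc: "\<And>x. c \<le> (x - z) \<bullet> (F x - (w + e))"
    using assms unfolding brezis_haraux_set_def by blast
  have "\<epsilon> * (norm x)\<^sup>2 / 2 + x \<bullet> e \<le> (norm z)\<^sup>2 / 2 + z \<bullet> e - c"
    if \<epsilon>: "0 < \<epsilon>" "\<epsilon> \<le> 1" and x: "\<epsilon> *\<^sub>R x + F x = w" for \<epsilon> x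
  proof -
    have Fx: "F x = w - \<epsilon> *\<^sub>R x" using x by (simp add: algebra_simps)
    have "0 \<le> (norm (x - z))\<^sup>2" by simp
    then have "x \<bullet> z \<le> (norm x)\<^sup>2 / 2 + (norm z)\<^sup>2 / 2"
      unfolding power2_norm_eq_inner by (simp add: inner_simps inner_commute)
    then have "\<epsilon> * (x \<bullet> z) \<le> \<epsilon> * ((norm x)\<^sup>2 / 2 + (norm z)\<^sup>2 / 2)"
      using \<epsilon> by (intro mult_left_mono) auto
    also have "\<dots> \<le> \<epsilon> * (norm x)\<^sup>2 / 2 + (norm z)\<^sup>2 / 2"
      using \<epsilon> mult_right_mono[of \<epsilon> 1 "(norm z)\<^sup>2 / 2"] by (simp add: algebra_simps)
    finally have cross: "\<epsilon> * (x \<bullet> z) \<le> \<epsilon> * (norm x)\<^sup>2 / 2 + (norm z)\<^sup>2 / 2" .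
    have "c \<le> (x - z) \<bullet> (F x - (w + e))" by (rule zc)
    also have "\<dots> = - \<epsilon> * (norm x)\<^sup>2 + \<epsilon> * (x \<bullet> z) - x \<bullet> e + z \<bullet> e"
      unfolding power2_norm_eq_inner Fx by (simp add: inner_simps inner_commute algebra_simps)
    finally show ?thesis using cross by simp
  qed
  then show ?thesis by (rule that)
qed

lemma brezis_haraux_set_subset_closure_range:
  fixes F :: "'a::{real_inner, complete_space} \<Rightarrow> 'a"
  assumes firm: "\<And>x y. (norm (F x - F y))\<^sup>2 \<le> (x - y) \<bullet> (F x - F y)"
  shows "brezis_haraux_set F \<subseteq> closure (range F)"
proof
  fix w assume "w \<in> brezis_haraux_set F"
  then have "w + 0 \<in> brezis_haraux_set F" by simp
  from tikhonov_bound[OF this] obtain K where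
    K: "\<And>\<epsilon> x. 0 < \<epsilon> \<Longrightarrow> \<epsilon> \<le> 1 \<Longrightarrow> \<epsilon> *\<^sub>R x + F x = w \<Longrightarrow> \<epsilon> * (norm x)\<^sup>2 / 2 + x \<bullet> 0 \<le> K"
    by metis
  show "w \<in> closure (range F)"
    unfolding closure_approachable
  proof safe
    fix e :: real assume "0 < e"
    \<comment> \<open>The residual satisfies \<open>\<parallel>F x - w\<parallel>\<^sup>2 = \<epsilon> * (\<epsilon> \<parallel>x\<parallel>\<^sup>2) \<le> 2 \<epsilon> K\<close>.\<close>
    define \<epsilon> where "\<epsilon> = min 1 (e\<^sup>2 / (4 * (\<bar>K\<bar> + 1)))"
    have \<epsilon>: "0 < \<epsilon>" "\<epsilon> \<le> 1"
      using \<open>0 < e\<close> by (auto simp: \<epsilon>_def intro!: divide_pos_pos)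
    have "\<epsilon> \<le> e\<^sup>2 / (4 * (\<bar>K\<bar> + 1))" by (simp add: \<epsilon>_def)
    then have small: "\<epsilon> * (4 * (\<bar>K\<bar> + 1)) \<le> e\<^sup>2" by (subst (asm) pos_le_divide_eq) auto
    obtain x where x: "\<epsilon> *\<^sub>R x + F x = w"
      using tikhonov_solution_exists[OF firm \<epsilon>(1)] by blast
    have "(norm (F x - w))\<^sup>2 = \<epsilon> * (\<epsilon> * (norm x)\<^sup>2)"
      by (simp add: power2_eq_square flip: x)
    also have "\<dots> \<le> \<epsilon> * (2 * K)"
      using K[OF \<epsilon>(1,2) x] \<epsilon> by (intro mult_left_mono) auto
    also have "\<dots> < \<epsilon> * (4 * (\<bar>K\<bar> + 1))"
      using \<epsilon>(1) by (intro mult_strict_left_mono) auto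
    also note small
    finally have "norm (F x - w) < e"
      using \<open>0 < e\<close> by (simp add: power2_less_imp_less)
    then show "\<exists>y\<in>range F. dist y w < e" by (auto simp: dist_norm)
  qed
qed

text \<open>Decreasing the regularization parameter from \<open>\<epsilon>\<close> to \<open>\<delta>\<close> increases the norm of the solution, and
  the solution moves no further than that increase permits. Monotonicity of \<open>F\<close> at the two solutions
  gives \<open>(x - y) \<bullet> (\<delta> y - \<epsilon> x) \<ge> 0\<close>, and expanding this yields the claim with the factor
  \<open>(\<epsilon> - \<delta>) / (\<epsilon> + \<delta>) \<le> 1\<close> on the right.\<close>

lemma tikhonov_norm_gap:
  fixes F :: "'a::real_inner \<Rightarrow> 'a"
  assumes mono: "\<And>x y. 0 \<le> (x - y) \<bullet> (F x - F y)"
    and "0 < \<delta>" "\<delta> \<le> \<epsilon>" "\<epsilon> *\<^sub>R x + F x = w" "\<delta> *\<^sub>R y + F y = w"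
  shows "(norm (x - y))\<^sup>2 \<le> (norm y)\<^sup>2 - (norm x)\<^sup>2"
proof -
  have "F x = w - \<epsilon> *\<^sub>R x" "F y = w - \<delta> *\<^sub>R y"
    using assms by (simp_all add: algebra_simps)
  then have "0 \<le> (x - y) \<bullet> (\<delta> *\<^sub>R y - \<epsilon> *\<^sub>R x)"
    using mono[of x y] by simp
  then have ineq: "2 * (\<epsilon> * (x \<bullet> x) + \<delta> * (y \<bullet> y)) \<le> 2 * ((\<epsilon> + \<delta>) * (x \<bullet> y))"
    by (simp add: inner_simps inner_commute algebra_simps)
  have "(\<epsilon> + \<delta>) * (norm (x - y))\<^sup>2
      = (\<epsilon> + \<delta>) * (x \<bullet> x + y \<bullet> y) - 2 * ((\<epsilon> + \<delta>) * (x \<bullet> y))"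
    unfolding power2_norm_eq_inner by (simp add: inner_simps inner_commute algebra_simps)
  also have "\<dots> \<le> (\<epsilon> + \<delta>) * (x \<bullet> x + y \<bullet> y) - 2 * (\<epsilon> * (x \<bullet> x) + \<delta> * (y \<bullet> y))"
    using ineq by simp
  also have "\<dots> = (\<epsilon> - \<delta>) * ((norm y)\<^sup>2 - (norm x)\<^sup>2)"
    unfolding power2_norm_eq_inner by (simp add: algebra_simps)
  finally have main: "(\<epsilon> + \<delta>) * (norm (x - y))\<^sup>2 \<le> (\<epsilon> - \<delta>) * ((norm y)\<^sup>2 - (norm x)\<^sup>2)" .
  show ?thesis
  proof (cases "\<epsilon> = \<delta>")
    case True
    then have "x = y" using main assms by (simp add: mult_le_0_iff)
    then show ?thesis by simp
  next
    case False
    then have lt: "\<delta> < \<epsilon>" using assms by simp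
    have "0 \<le> (\<epsilon> - \<delta>) * ((norm y)\<^sup>2 - (norm x)\<^sup>2)"
      using main assms by (smt (verit) mult_nonneg_nonneg zero_le_power2)
    then have "0 \<le> (norm y)\<^sup>2 - (norm x)\<^sup>2" using lt by (simp add: zero_le_mult_iff)
    then have "(\<epsilon> - \<delta>) * ((norm y)\<^sup>2 - (norm x)\<^sup>2) \<le> (\<epsilon> + \<delta>) * ((norm y)\<^sup>2 - (norm x)\<^sup>2)"
      using assms by (intro mult_right_mono) auto
    with main have "(\<epsilon> + \<delta>) * (norm (x - y))\<^sup>2 \<le> (\<epsilon> + \<delta>) * ((norm y)\<^sup>2 - (norm x)\<^sup>2)"
      by linarith
    then show ?thesis using assms by simp
  qed
qed

text \<open>Along \<open>\<epsilon> = 1 / (n + 1)\<close> the squared norms of the solutions increase, and when they are bounded,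
  the gap estimate makes the solutions themselves a Cauchy sequence.\<close>

lemma range_if_bounded_tikhonov:
  fixes F :: "'a::{real_inner, complete_space} \<Rightarrow> 'a"
  assumes firm: "\<And>x y. (norm (F x - F y))\<^sup>2 \<le> (x - y) \<bullet> (F x - F y)"
    and bdd: "bounded {x. \<exists>\<epsilon>>0. \<epsilon> \<le> 1 \<and> \<epsilon> *\<^sub>R x + F x = w}"
  shows "w \<in> range F"
proof -
  have mono: "0 \<le> (x - y) \<bullet> (F x - F y)" for x y
    using firm[of x y] by (smt (verit) zero_le_power2)
  have lip: "norm (F x - F y) \<le> norm (x - y)" for x y
  proof (cases "F x = F y")
    case False
    have "norm (F x - F y) * norm (F x - F y) \<le> norm (x - y) * norm (F x - F y)"
      using firm[of x y] norm_cauchy_schwarz[of "x - y" "F x - F y"]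
      by (simp add: power2_eq_square)
    then show ?thesis using False by simp
  qed simp
  have "\<exists>x. inverse (real (Suc n)) *\<^sub>R x + F x = w" for n
    by (rule tikhonov_solution_exists[OF firm]) simp
  then obtain x where x: "\<And>n. inverse (real (Suc n)) *\<^sub>R x n + F (x n) = w" by metis
  obtain K where K: "\<And>n. norm (x n) \<le> K"
  proof -
    from bdd obtain K where "\<And>y. y \<in> {x. \<exists>\<epsilon>>0. \<epsilon> \<le> 1 \<and> \<epsilon> *\<^sub>R x + F x = w} \<Longrightarrow> norm y \<le> K"
      unfolding bounded_iff by blast
    moreover have "x n \<in> {x. \<exists>\<epsilon>>0. \<epsilon> \<le> 1 \<and> \<epsilon> *\<^sub>R x + F x = w}" for n
      using x[of n] by (auto intro!: exI[of _ "inverse (real (Suc n))"] simp: inverse_le_1_iff)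
    ultimately show thesis using that by blast
  qed
  have gap: "(norm (x i - x j))\<^sup>2 \<le> (norm (x j))\<^sup>2 - (norm (x i))\<^sup>2" if "i \<le> j" for i j
    using that by (intro tikhonov_norm_gap[OF mono _ _ x x]) (auto intro: le_imp_inverse_le)
  have "incseq (\<lambda>n. (norm (x n))\<^sup>2)"
  proof (rule incseq_SucI)
    show "(norm (x n))\<^sup>2 \<le> (norm (x (Suc n)))\<^sup>2" for n
      using gap[of n "Suc n"] zero_le_power2[of "norm (x n - x (Suc n))"] by linarith
  qed
  moreover have "(norm (x n))\<^sup>2 \<le> K\<^sup>2" for n using K by (intro power_mono) auto
  ultimately have "convergent (\<lambda>n. (norm (x n))\<^sup>2)"
    using incseq_convergent by (metis convergent_def)
  then have cau: "Cauchy (\<lambda>n. (norm (x n))\<^sup>2)" by (rule convergent_Cauchy)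
  have "Cauchy x"
  proof (rule CauchyI')
    fix e :: real assume "0 < e"
    then have "0 < e\<^sup>2" by simp
    from CauchyD[OF cau this] obtain N where
      N: "\<And>i j. N \<le> i \<Longrightarrow> N \<le> j \<Longrightarrow> norm ((norm (x i))\<^sup>2 - (norm (x j))\<^sup>2) < e\<^sup>2" by blast
    have "dist (x i) (x j) < e" if "i \<ge> N" "j > i" for i j
    proof -
      have "(norm (x i - x j))\<^sup>2 < e\<^sup>2"
        using gap[of i j] N[of i j] that by simp
      then show ?thesis using \<open>0 < e\<close> by (simp add: dist_norm power2_less_imp_less)
    qed
    then show "\<exists>M. \<forall>i\<ge>M. \<forall>j>i. dist (x i) (x j) < e" by blast
  qed
  then obtain y where y: "x \<longlonglongrightarrow> y"
    by (auto simp: Cauchy_convergent_iff convergent_def)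
  have "(\<lambda>n. F (x n)) \<longlonglongrightarrow> F y"
  proof (rule metric_tendsto_imp_tendsto[OF y])
    show "\<forall>\<^sub>F n in sequentially. dist (F (x n)) (F y) \<le> dist (x n) y"
      using lip by (simp add: dist_norm)
  qed
  with y have "(\<lambda>n. inverse (real (Suc n)) *\<^sub>R x n + F (x n)) \<longlonglongrightarrow> 0 *\<^sub>R y + F y"
    by (intro tendsto_intros LIMSEQ_inverse_real_of_nat)
  then have "F y = w" unfolding x by (simp add: LIMSEQ_const_iff)
  then show ?thesis by blast
qed

text \<open>The Banach--Steinhaus theorem for the functionals \<open>x \<bullet> _\<close> on the Hilbert space \<open>S\<close>. The bounds
  are one-sided because they are derived so; applying them to \<open>- e\<close> makes up for it. By
  Baire's theorem some sublevel set \<open>E n\<close> contains a relative ball about a point \<open>e0\<close>, and moving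
  from \<open>e0\<close> in the direction of \<open>x\<close> makes \<open>x \<bullet> e\<close> grow in proportion to \<open>norm x\<close>.\<close>

lemma uniform_boundedness_inner:
  fixes S X :: "'a::{real_inner, complete_space} set"
  assumes "subspace S" "closed S" "X \<subseteq> S"
    and ptw: "\<And>e. e \<in> S \<Longrightarrow> \<exists>K. \<forall>x\<in>X. x \<bullet> e \<le> K"
  shows "bounded X"
proof -
  define E where "E n = S \<inter> {e. \<forall>x\<in>X. x \<bullet> e \<le> real n}" for n
  have clE: "closed (E n)" for n
  proof -
    have "{e. \<forall>x\<in>X. x \<bullet> e \<le> real n} = (\<Inter>x\<in>X. {e. x \<bullet> e \<le> real n})" by auto
    then show ?thesis unfolding E_def using assms(2)
      by (auto intro!: closed_Int closed_INT closed_Collect_le continuous_intros)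
  qed
  have "S \<subseteq> (\<Union>n. E n)"
  proof
    fix e assume "e \<in> S"
    then obtain K where K: "\<forall>x\<in>X. x \<bullet> e \<le> K" using ptw by blast
    obtain n where "K \<le> real n" using real_arch_simple by blast
    with K \<open>e \<in> S\<close> have "e \<in> E n" by (auto simp: E_def intro: order_trans)
    then show "e \<in> (\<Union>n. E n)" by blast
  qed
  then have U: "(\<Union>n. E n) = S" by (auto simp: E_def)
  have cm: "completely_metrizable_space (top_of_set S)"
    using assms(2) by (intro completely_metrizable_space_closedin completely_metrizable_space_euclidean) auto
  have "\<exists>n. top_of_set S interior_of E n \<noteq> {}"
  proof (rule ccontr)
    assume "\<not> ?thesis"
    then have "top_of_set S interior_of \<Union>(range E) = {}"
      using clE cm by (intro Baire_category_alt) (auto simp: closed_subset E_def)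
    moreover have "top_of_set S interior_of S = S"
      by (metis interior_of_topspace topspace_euclidean_subtopology)
    ultimately show False using U subspace_0[OF assms(1)] by auto
  qed
  then obtain n e0 where "e0 \<in> top_of_set S interior_of E n" by blast
  then obtain U where "openin (top_of_set S) U" "e0 \<in> U" "U \<subseteq> E n"
    by (auto simp: interior_of_def)
  then obtain r where r: "0 < r" "e0 \<in> S" "\<And>e. e \<in> S \<Longrightarrow> dist e e0 < r \<Longrightarrow> e \<in> E n"
    unfolding openin_euclidean_subtopology_iff by blast
  obtain K where K: "\<And>x. x \<in> X \<Longrightarrow> x \<bullet> (- e0) \<le> K"
    using ptw[of "- e0"] r(2) subspace_neg[OF assms(1)] by blast
  have "norm x \<le> max 0 (2 * (n + K) / r)" if "x \<in> X" for x
  proof (cases "x = 0")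
    case False
    \<comment> \<open>The point of the ball about \<open>e0\<close> in the direction of \<open>x\<close>, at half the radius.\<close>
    define e where "e = e0 + (r / (2 * norm x)) *\<^sub>R x"
    have "e \<in> S" unfolding e_def
      using that assms r by (intro subspace_add subspace_scale) auto
    moreover have "dist e e0 < r" using False r(1) by (simp add: e_def dist_norm)
    ultimately have "e \<in> E n" by (rule r(3))
    then have "x \<bullet> e \<le> n" using that by (simp add: E_def)
    moreover have "x \<bullet> e = x \<bullet> e0 + r * norm x / 2"
      using False by (simp add: e_def inner_simps dot_square_norm power2_eq_square)
    ultimately have "r * norm x / 2 \<le> n + K" using K[OF that] by simp
    then show ?thesis using r(1) by (simp add: field_simps le_max_iff_disj)
  qed simp
  then show ?thesis unfolding bounded_iff by blast
qed

text \<open>Let \<open>S\<close> be the direction space of the closed affine hull \<open>V\<close>. As \<open>w\<close> is relatively interior, the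
  Brezis--Haraux condition holds at \<open>w + s e\<close> for each \<open>e \<in> S\<close> and small \<open>s > 0\<close>, which bounds
  \<open>x \<bullet> e\<close> over the Tikhonov solutions \<open>x\<close>. These belong to \<open>S\<close> because \<open>\<epsilon> x = w - F x\<close> is a
  difference of points of \<open>V\<close>, so boundedness on \<open>S\<close> is boundedness in norm.\<close>

lemma rint_brezis_haraux_set_subset_range:
  fixes F :: "'a::{real_inner, complete_space} \<Rightarrow> 'a"
  assumes firm: "\<And>x y. (norm (F x - F y))\<^sup>2 \<le> (x - y) \<bullet> (F x - F y)"
    and "range F \<subseteq> brezis_haraux_set F"
  shows "rint (brezis_haraux_set F) \<subseteq> range F"
proof
  fix w assume w: "w \<in> rint (brezis_haraux_set F)"
  define V where "V = closed_affine_hull (brezis_haraux_set F)"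
  define S where "S = (\<lambda>v. v - w) ` V"
  define X where "X = {x. \<exists>\<epsilon>>0. \<epsilon> \<le> 1 \<and> \<epsilon> *\<^sub>R x + F x = w}"
  obtain r where wV: "w \<in> V" and r: "0 < r"
    "\<And>z. z \<in> V \<Longrightarrow> dist z w < r \<Longrightarrow> z \<in> brezis_haraux_set F"
    using w unfolding rint_iff V_def by blast
  have S_iff: "e \<in> S \<longleftrightarrow> w + e \<in> V" for e
    by (auto simp: S_def image_iff intro!: bexI[of _ "w + e"])
  have "subspace S"
    unfolding S_def using affine_diffs_subspace_subtract[of V w] wV
    by (simp add: V_def affine_closed_affine_hull)
  have "closed S"
    unfolding S_def V_def by (intro closed_translation_subtract closed_closed_affine_hull)
  have "X \<subseteq> S"
  proof
    fix x assume "x \<in> X"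
    then obtain \<epsilon> where \<epsilon>: "0 < \<epsilon>" "\<epsilon> *\<^sub>R x + F x = w" by (auto simp: X_def)
    have "F x \<in> V" using assms(2) subset_closed_affine_hull unfolding V_def by blast
    then have "F x - w \<in> S" by (simp add: S_def)
    then have "(- inverse \<epsilon>) *\<^sub>R (F x - w) \<in> S" by (rule subspace_scale[OF \<open>subspace S\<close>])
    moreover have "(- inverse \<epsilon>) *\<^sub>R (F x - w) = x"
      using \<epsilon> by (simp flip: \<epsilon>(2))
    ultimately show "x \<in> S" by simp
  qed
  have "bounded X"
  proof (rule uniform_boundedness_inner[OF \<open>subspace S\<close> \<open>closed S\<close> \<open>X \<subseteq> S\<close>])
    fix e assume "e \<in> S"
    define s where "s = r / (2 * (norm e + 1))"
    have s: "0 < s" using r(1) by (simp add: s_def add_nonneg_pos)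
    have "s * norm e < r"
    proof -
      have "s * norm e \<le> s * (norm e + 1)" using s by simp
      also have "\<dots> = r / 2"
        using norm_ge_zero[of e] by (simp add: s_def field_simps del: norm_ge_zero)
      also have "\<dots> < r" using r(1) by simp
      finally show ?thesis .
    qed
    moreover have "w + s *\<^sub>R e \<in> V"
      using \<open>e \<in> S\<close> subspace_scale[OF \<open>subspace S\<close>] S_iff by blast
    ultimately have "w + s *\<^sub>R e \<in> brezis_haraux_set F"
      using s by (intro r(2)) (auto simp: dist_norm)
    from tikhonov_bound[OF this] obtain K where
      K: "\<And>\<epsilon> x. 0 < \<epsilon> \<Longrightarrow> \<epsilon> \<le> 1 \<Longrightarrow> \<epsilon> *\<^sub>R x + F x = w \<Longrightarrow>
             \<epsilon> * (norm x)\<^sup>2 / 2 + x \<bullet> (s *\<^sub>R e) \<le> K"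
      by metis
    have "x \<bullet> e \<le> K / s" if "x \<in> X" for x
    proof -
      obtain \<epsilon> where \<epsilon>: "0 < \<epsilon>" "\<epsilon> \<le> 1" "\<epsilon> *\<^sub>R x + F x = w"
        using \<open>x \<in> X\<close> unfolding X_def by blast
      have "0 \<le> \<epsilon> * (norm x)\<^sup>2 / 2" using \<epsilon> by simp
      then have "s * (x \<bullet> e) \<le> K" using K[OF \<epsilon>] by simp
      then show ?thesis using s by (simp add: field_simps)
    qed
    then show "\<exists>K. \<forall>x\<in>X. x \<bullet> e \<le> K" by blast
  qed
  then show "w \<in> range F"
    unfolding X_def by (rule range_if_bounded_tikhonov[OF firm])
qed

section \<open>Near equality for the Douglas--Rachford operator\<close>

lemma less_INF_ereal_lower_bound:
  fixes f :: "'b \<Rightarrow> real"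
  assumes "(INF p\<in>G. ereal (f p)) > -\<infinity>"
  obtains c where "\<And>p. p \<in> G \<Longrightarrow> c \<le> f p"
proof -
  obtain c where "ereal c < (INF p\<in>G. ereal (f p))"
    using ereal_dense2[OF assms] by blast
  then have "c \<le> f p" if "p \<in> G" for p
    using less_INF_D[OF _ that] by fastforce
  then show ?thesis by (rule that)
qed

theorem theorem14:
  fixes A B :: "'a::{real_inner, complete_space} \<Rightarrow> 'a set"
    and T :: "'a \<Rightarrow> 'a"
    and W :: "'a set"
  assumes "maximally_monotone_op A"
    and "maximally_monotone_op B"
    and "T = douglas_rachford A B"
    and "range (\<lambda>x. x - T x) \<subseteq> W"
    and "\<forall>w\<in>W. \<exists>a b p q. w = a - b \<and> w = p + q
           \<and> (INF (x, u)\<in>gra A. ereal ((x - a) \<bullet> (u - p))) > -\<infinity>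
           \<and> (INF (y, v)\<in>gra B. ereal ((y - b) \<bullet> (v - q))) > -\<infinity>"
  shows "range (\<lambda>x. x - T x) \<simeq> W \<and> W \<simeq> convex hull W"
proof -
  define F where "F = (\<lambda>x. x - T x)"
  have split: "\<exists>a u b v. u \<in> A a \<and> v \<in> B b \<and> x = a + u \<and> a - b = u + v \<and> F x = a - b" for x
    using douglas_rachford_split[OF assms(1,2), of x] unfolding F_def assms(3) by metis
  have firm: "(norm (F x - F y))\<^sup>2 \<le> (x - y) \<bullet> (F x - F y)" for x y
  proof -
    obtain a u b v where x: "u \<in> A a" "v \<in> B b" "x = a + u" "a - b = u + v" "F x = a - b"
      using split by blast
    obtain a' u' b' v' where
      y: "u' \<in> A a'" "v' \<in> B b'" "y = a' + u'" "a' - b' = u' + v'" "F y = a' - b'"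
      using split by blast
    have "(x - y) \<bullet> (F x - F y)
        = (norm (F x - F y))\<^sup>2 + ((a - a') \<bullet> (u - u') + (b - b') \<bullet> (v - v'))"
      using douglas_rachford_displacement_inner[of "F y" a' b' u' v' a b u v] x y by simp
    moreover have "0 \<le> (a - a') \<bullet> (u - u')" "0 \<le> (b - b') \<bullet> (v - v')"
      using maximally_monotone_op_mono[OF assms(1)] maximally_monotone_op_mono[OF assms(2)] x y
      by blast+
    ultimately show ?thesis by simp
  qed
  have W: "W \<subseteq> brezis_haraux_set F"
  proof
    fix w assume "w \<in> W"
    then obtain a b p q where w: "w = a - b" "w = p + q"
      and inf: "(INF s\<in>gra A. ereal ((fst s - a) \<bullet> (snd s - p))) > -\<infinity>"
        "(INF s\<in>gra B. ereal ((fst s - b) \<bullet> (snd s - q))) > -\<infinity>"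
      using assms(5) unfolding case_prod_beta by blast
    obtain c where c: "\<And>s. s \<in> gra A \<Longrightarrow> c \<le> (fst s - a) \<bullet> (snd s - p)"
      using less_INF_ereal_lower_bound[OF inf(1)] by metis
    obtain d where d: "\<And>s. s \<in> gra B \<Longrightarrow> d \<le> (fst s - b) \<bullet> (snd s - q)"
      using less_INF_ereal_lower_bound[OF inf(2)] by metis
    have "c + d \<le> (x - (a + p)) \<bullet> (F x - w)" for x
    proof -
      obtain a1 u b1 v where x: "u \<in> A a1" "v \<in> B b1" "x = a1 + u" "a1 - b1 = u + v" "F x = a1 - b1"
        using split by blast
      have "c \<le> (a1 - a) \<bullet> (u - p)" "d \<le> (b1 - b) \<bullet> (v - q)"
        using c[of "(a1, u)"] d[of "(b1, v)"] x by (auto simp: gra_def)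
      then have "c + d \<le> (norm (F x - w))\<^sup>2 + ((a1 - a) \<bullet> (u - p) + (b1 - b) \<bullet> (v - q))"
        using zero_le_power2[of "norm (F x - w)"] by linarith
      also have "\<dots> = (x - (a + p)) \<bullet> (F x - w)"
        using douglas_rachford_displacement_inner[OF w x(4)] x(3,5) by simp
      finally show ?thesis .
    qed
    then show "w \<in> brezis_haraux_set F" unfolding brezis_haraux_set_def by blast
  qed
  have ran: "range F \<subseteq> W" using assms(4) by (simp add: F_def)
  have conv: "W \<subseteq> convex hull W" "convex hull W \<subseteq> brezis_haraux_set F"
    using W by (simp_all add: hull_subset hull_minimal convex_brezis_haraux_set)
  have closure: "brezis_haraux_set F \<subseteq> closure (range F)"
    by (rule brezis_haraux_set_subset_closure_range[OF firm])
  have interior: "rint (brezis_haraux_set F) \<subseteq> range F"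
    using ran W by (intro rint_brezis_haraux_set_subset_range[OF firm]) auto
  have "range F \<simeq> W"
    using ran W closure interior by (rule nearly_equal_if_sandwiched)
  moreover have "W \<simeq> convex hull W"
  proof (rule nearly_equal_if_sandwiched[OF conv])
    show "brezis_haraux_set F \<subseteq> closure W" using closure closure_mono[OF ran] by blast
    show "rint (brezis_haraux_set F) \<subseteq> W" using interior ran by blast
  qed
  ultimately show ?thesis by (simp add: F_def)
qed

end
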